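(* Let $n\in\mathbb{N}$. For every $m\in\mathbb{N}_0$ and every subset $J\subseteq\mathcal{Z}_n$ (possibly empty) one has $$\mathcal{E}_m(J)=\begin{cases}(-1)^{m}\mathcal{H}_{m}(\mathcal{Z}_n\setminus J)+(-1)^{m-1}\mathcal{H}_{m-n}(\mathcal{Z}_n\setminus J) & \text{if } n\le m,\\ (-1)^{m}\mathcal{H}_{m}(\mathcal{Z}_n\setminus J) & \text{otherwise.}\end{cases}$$
   Context: $\mathbb{N}=\{1,2,\ldots\}$, $\mathbb{N}_0=\mathbb{N}\cup\{0\}$. $\zeta_n:=e^{2\pi i/n}$ and $\mathcal{Z}_n:=\{1,\zeta_n,\ldots,\zeta_n^{n-1}\}$ is the set of $n$th roots of unity in $\mathbb{C}$. For a finite nonempty set $A=\{z_1,\ldots,z_r\}$ of complex numbers, the elementary symmetric polynomials are $\mathcal{E}_0(A):=1$, $\mathcal{E}_m(A):=\sum_{1\le j_1<\cdots<j_m\le r}z_{j_1}\cdots z_{j_m}$ for $1\le m\le r$, $\mathcal{E}_m(A):=0$ for $m>r$; the complete homogeneous symmetric polynomials are $\mathcal{H}_0(A):=1$ and $\mathcal{H}_m(A):=\sum_{1\le j_1\le\cdots\le j_m\le r}z_{j_1}\cdots z_{j_m}$ for $m\ge1$. Convention: $\mathcal{H}_m(\emptyset)=\mathcal{E}_m(\emptyset):=1$ if $m=0$ and $:=0$ otherwise. *)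

theory Defs
  imports Complex_Main "HOL-Library.Multiset"
begin

definition zeta :: "nat \<Rightarrow> complex" where
  "zeta n = exp (2 * of_real pi * \<i> / of_nat n)"

definition roots_of_unity :: "nat \<Rightarrow> complex set" where
  "roots_of_unity n = {zeta n ^ k | k. k < n}"

(* For A = {z_1, ..., z_r} with the z_j distinct, strictly increasing index tuples
   j_1 < ... < j_m correspond to the m-element subsets of A, and weakly increasing ones
   to the multisets of size m over A. The definitions below sum over these, so they need
   no enumeration of A. They are meaningful for finite A only. *)

definition elem_sym :: "nat \<Rightarrow> complex set \<Rightarrow> complex" where
  "elem_sym m A = (\<Sum>S \<in> {S. S \<subseteq> A \<and> finite S \<and> card S = m}. \<Prod>S)"

definition complete_hom_sym :: "nat \<Rightarrow> complex set \<Rightarrow> complex" where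
  "complete_hom_sym m A = (\<Sum>M \<in> multisets_of_size A m. \<Prod>\<^sub># M)"

(* The boundary conventions, including those for the empty set, follow from the definitions. *)

lemma elem_sym_0: "elem_sym 0 A = 1"
proof -
  have "{S. S \<subseteq> A \<and> finite S \<and> card S = 0} = {{}}" by auto
  then show ?thesis by (simp add: elem_sym_def)
qed

lemma elem_sym_eq_0:
  assumes "finite A" and "card A < m"
  shows "elem_sym m A = 0"
proof -
  have "{S. S \<subseteq> A \<and> finite S \<and> card S = m} = {}"
    using assms by (auto dest: card_mono[OF assms(1)])
  then show ?thesis unfolding elem_sym_def by (simp only: sum.empty)
qed

lemma elem_sym_empty: "elem_sym m {} = (if m = 0 then 1 else 0)"
  by (simp add: elem_sym_0 elem_sym_eq_0)

lemma complete_hom_sym_0: "complete_hom_sym 0 A = 1"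
  by (simp add: complete_hom_sym_def)

lemma complete_hom_sym_empty: "complete_hom_sym m {} = (if m = 0 then 1 else 0)"
  by (simp add: complete_hom_sym_def)

lemma finite_roots_of_unity: "finite (roots_of_unity n)"
  by (simp add: roots_of_unity_def)

end

theory Submission
  imports Defs "HOL-Computational_Algebra.Polynomial_FPS"
begin

text \<open>
  In formal power series, \<open>\<Sum>m. (-1)^m * E\<^sub>m(J) X^m\<close> is the product of the factors \<open>1 - z X\<close> over
  \<open>z \<in> J\<close>, while \<open>\<Sum>m. H\<^sub>m(K) X^m\<close> is the inverse of the same product over \<open>K\<close>. The product over all
  \<open>n\<close>-th roots of unity is \<open>1 - X^n\<close>, so for complementary \<open>J\<close> and \<open>K\<close> the first series is
  \<open>1 - X^n\<close> times the second; comparing coefficients gives the identity.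
\<close>

text \<open>Sort the subsets by whether they contain \<open>a\<close>; deleting \<open>a\<close>
  matches those that do with the \<open>m\<close>-subsets of \<open>A\<close>.\<close>

lemma elem_sym_Suc_insert:
  assumes "finite A" "a \<notin> A"
  shows "elem_sym (Suc m) (insert a A) = elem_sym (Suc m) A + a * elem_sym m A"
proof -
  let ?P = "\<lambda>k. {S. S \<subseteq> A \<and> finite S \<and> card S = k}"
  have fin: "finite (?P k)" for k
    by (rule finite_subset[of _ "Pow A"]) (use assms in auto)
  have inj: "inj_on (insert a) (?P m)"
    using assms by (auto simp: inj_on_def)
  have split: "{S. S \<subseteq> insert a A \<and> finite S \<and> card S = Suc m} = ?P (Suc m) \<union> insert a ` ?P m"
    (is "?L = ?R")
  proof (intro equalityI subsetI)
    fix S assume S: "S \<in> ?L"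
    show "S \<in> ?R"
    proof (cases "a \<in> S")
      case True
      then have "S = insert a (S - {a})" "S - {a} \<in> ?P m"
        using S by auto
      then show ?thesis by blast
    qed (use S in auto)
  next
    fix S assume "S \<in> ?R"
    then show "S \<in> ?L"
      using assms by (auto simp: card_insert_if)
  qed
  have "elem_sym (Suc m) (insert a A) = (\<Sum>S\<in>?P (Suc m). \<Prod>S) + (\<Sum>S\<in>insert a ` ?P m. \<Prod>S)"
    unfolding elem_sym_def split
    by (rule sum.union_disjoint) (use fin assms in auto)
  also have "(\<Sum>S\<in>insert a ` ?P m. \<Prod>S) = (\<Sum>S\<in>?P m. a * \<Prod>S)"
    unfolding sum.reindex[OF inj] o_def
    by (rule sum.cong) (use assms in \<open>auto intro!: prod.insert\<close>)
  finally show ?thesis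
    by (simp add: elem_sym_def sum_distrib_left)
qed

text \<open>Sort the multisets by whether \<open>a\<close> occurs. Removing one copy of
  \<open>a\<close> may leave further copies, so the last term still ranges over
  \<open>insert a A\<close>, in contrast to the recurrence for \<open>elem_sym\<close>.\<close>

lemma complete_hom_sym_Suc_insert:
  assumes "finite A" "a \<notin> A"
  shows "complete_hom_sym (Suc m) (insert a A)
           = complete_hom_sym (Suc m) A + a * complete_hom_sym m (insert a A)"
proof -
  let ?M = multisets_of_size
  have inj: "inj_on (add_mset a) (?M (insert a A) m)"
    by (auto simp: inj_on_def)
  have split: "?M (insert a A) (Suc m) = ?M A (Suc m) \<union> add_mset a ` ?M (insert a A) m"
    (is "?L = ?R")
  proof (intro equalityI subsetI)
    fix X assume X: "X \<in> ?L"
    show "X \<in> ?R"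
    proof (cases "a \<in># X")
      case True
      then obtain Y where "X = add_mset a Y"
        by (metis insert_DiffM)
      then show ?thesis
        using X by (auto simp: multisets_of_size_def)
    qed (use X in \<open>auto simp: multisets_of_size_def\<close>)
  qed (auto simp: multisets_of_size_def)
  have "complete_hom_sym (Suc m) (insert a A)
          = (\<Sum>X\<in>?M A (Suc m). \<Prod>\<^sub># X) + (\<Sum>X\<in>add_mset a ` ?M (insert a A) m. \<Prod>\<^sub># X)"
    unfolding complete_hom_sym_def split
    by (rule sum.union_disjoint)
       (use assms in \<open>auto simp: finite_multisets_of_size, auto simp: multisets_of_size_def\<close>)
  also have "(\<Sum>X\<in>add_mset a ` ?M (insert a A) m. \<Prod>\<^sub># X) = (\<Sum>X\<in>?M (insert a A) m. a * \<Prod>\<^sub># X)"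
    unfolding sum.reindex[OF inj] by simp
  finally show ?thesis
    by (simp add: complete_hom_sym_def sum_distrib_left)
qed

lemma fps_nth_one_minus_const_X_mult:
  fixes F :: "'a::comm_ring_1 fps"
  shows "fps_nth ((1 - fps_const a * fps_X) * F) m
           = fps_nth F m - (if m = 0 then 0 else a * fps_nth F (m - 1))"
proof -
  have "(1 - fps_const a * fps_X) * F = F - fps_const a * (fps_X * F)"
    by (simp add: algebra_simps)
  then show ?thesis
    by simp
qed

text \<open>Read coefficientwise, the insertion recurrence says that adding \<open>a\<close> to the
  set multiplies the series by \<open>1 - a X\<close>; the sign \<open>(-1) ^ m\<close> turns its
  plus into the minus of this factor.\<close>

lemma elem_sym_generating_function:
  assumes "finite A"
  shows "Abs_fps (\<lambda>m. (-1) ^ m * elem_sym m A) = (\<Prod>z\<in>A. 1 - fps_const z * fps_X)"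
  using assms
proof induction
  case empty
  show ?case
    by (rule fps_ext) (simp add: elem_sym_empty)
next
  case (insert a A)
  have "Abs_fps (\<lambda>m. (-1) ^ m * elem_sym m (insert a A))
          = (1 - fps_const a * fps_X) * Abs_fps (\<lambda>m. (-1) ^ m * elem_sym m A)"
  proof (rule fps_ext)
    fix m
    show "fps_nth (Abs_fps (\<lambda>m. (-1) ^ m * elem_sym m (insert a A))) m
            = fps_nth ((1 - fps_const a * fps_X) * Abs_fps (\<lambda>m. (-1) ^ m * elem_sym m A)) m"
      using insert.hyps
      by (cases m)
         (simp_all add: fps_nth_one_minus_const_X_mult elem_sym_0 elem_sym_Suc_insert algebra_simps)
  qed
  then show ?case
    using insert by simp
qed

text \<open>Here the recurrence says that multiplying by \<open>1 - a X\<close> removes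
  \<open>a\<close> from the set, so the factors cancel one by one down to the series 1 of the empty
  set. The product form avoids division of power series.\<close>

lemma complete_hom_sym_generating_function:
  assumes "finite A"
  shows "(\<Prod>z\<in>A. 1 - fps_const z * fps_X) * Abs_fps (\<lambda>m. complete_hom_sym m A) = 1"
  using assms
proof induction
  case empty
  show ?case
    by (rule fps_ext) (simp add: complete_hom_sym_empty)
next
  case (insert a A)
  have "(1 - fps_const a * fps_X) * Abs_fps (\<lambda>m. complete_hom_sym m (insert a A))
          = Abs_fps (\<lambda>m. complete_hom_sym m A)"
  proof (rule fps_ext)
    fix m
    show "fps_nth ((1 - fps_const a * fps_X) * Abs_fps (\<lambda>m. complete_hom_sym m (insert a A))) m
            = fps_nth (Abs_fps (\<lambda>m. complete_hom_sym m A)) m"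
      using insert.hyps
      by (cases m)
         (simp_all add: fps_nth_one_minus_const_X_mult complete_hom_sym_0 complete_hom_sym_Suc_insert)
  qed
  then show ?case
    using insert by (simp add: mult.assoc mult.left_commute[of _ "prod _ A"])
qed

text \<open>The powers of \<open>zeta n\<close> are the points \<open>cis (2 * pi * k / n)\<close>,
  known to be all solutions of \<open>z ^ n = 1\<close>. The equation makes closure under inverses
  immediate.\<close>

lemma roots_of_unity_eq:
  assumes "n > 0"
  shows "roots_of_unity n = {z. z ^ n = 1}"
proof -
  have "zeta n ^ k = cis (2 * pi * real k / real n)" for k
    by (simp add: zeta_def cis_conv_exp mult_ac flip: exp_of_nat_mult)
  then have "roots_of_unity n = (\<lambda>k. cis (2 * pi * real k / real n)) ` {..<n}"
    by (auto simp: roots_of_unity_def)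
  then show ?thesis
    using bij_betw_roots_unity[OF assms] by (simp add: bij_betw_def)
qed

text \<open>Both sides have degree at most \<open>n\<close> and agree at \<open>n + 1\<close>
  points: they are 1 at 0 and vanish at every root of unity. Working with polynomials permits this
  evaluation argument.\<close>

lemma prod_roots_of_unity_poly:
  assumes "n > 0"
  shows "(\<Prod>z\<in>roots_of_unity n. [:1, - z:]) = 1 - monom 1 n"
proof -
  let ?R = "roots_of_unity n"
  have "card ?R = n" and "0 \<notin> ?R"
    using assms by (simp_all add: roots_of_unity_eq card_roots_unity_eq zero_power)
  then have card: "card (insert 0 ?R) = Suc n"
    by (simp add: finite_roots_of_unity)
  show ?thesis
  proof (rule poly_eqI_degree)
    fix x assume "x \<in> insert 0 ?R"
    then consider "x = 0" | "x \<noteq> 0" "x ^ n = 1"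
      using assms \<open>0 \<notin> ?R\<close> by (auto simp: roots_of_unity_eq)
    then show "poly (\<Prod>z\<in>?R. [:1, - z:]) x = poly (1 - monom 1 n) x"
    proof cases
      case 1
      then show ?thesis
        using assms by (simp add: poly_prod poly_monom zero_power)
    next
      case 2
      \<comment> \<open>The factor vanishing at \<open>x\<close> is the one indexed by its
        inverse.\<close>
      then have "inverse x \<in> ?R"
        using assms by (simp add: roots_of_unity_eq power_inverse)
      moreover have "poly [:1, - inverse x:] x = 0"
        using 2 by simp
      ultimately have "poly (\<Prod>z\<in>?R. [:1, - z:]) x = 0"
        unfolding poly_prod using finite_roots_of_unity by (blast intro: prod_zero)
      then show ?thesis
        using 2 by (simp add: poly_monom)
    qed
  next
    have "degree (\<Prod>z\<in>?R. [:1, - z:]) \<le> (\<Sum>z\<in>?R. degree [:1, - z:])"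
      using degree_prod_sum_le[OF finite_roots_of_unity, of "\<lambda>z. [:1, - z:]" n] by (simp add: o_def)
    also have "\<dots> \<le> (\<Sum>z\<in>?R. 1)"
      by (rule sum_mono) simp
    finally show "degree (\<Prod>z\<in>?R. [:1, - z:]) < card (insert 0 ?R)"
      using card \<open>card ?R = n\<close> by simp
    have "degree (1 - monom 1 n :: complex poly) \<le> n"
      by (rule degree_diff_le) (simp_all add: degree_monom_le)
    then show "degree (1 - monom 1 n :: complex poly) < card (insert 0 ?R)"
      using card by simp
  qed
qed

lemma prod_roots_of_unity_fps:
  assumes "n > 0"
  shows "(\<Prod>z\<in>roots_of_unity n. 1 - fps_const z * fps_X) = 1 - fps_X ^ n"
proof -
  have "(\<Prod>z\<in>roots_of_unity n. 1 - fps_const z * fps_X)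
          = fps_of_poly (\<Prod>z\<in>roots_of_unity n. [:1, - z:])"
    by (simp add: fps_of_poly_prod fps_of_poly_linear' flip: fps_const_neg)
  also have "\<dots> = 1 - fps_X ^ n"
    by (simp add: prod_roots_of_unity_poly[OF assms] fps_of_poly_diff fps_of_poly_monom)
  finally show ?thesis .
qed

theorem corollary1p5:
  fixes n m :: nat and J :: "complex set"
  assumes "n \<ge> 1" and "J \<subseteq> roots_of_unity n"
  shows "elem_sym m J =
    (if n \<le> m
     then (-1) ^ m * complete_hom_sym m (roots_of_unity n - J)
          + (-1) ^ (m - 1) * complete_hom_sym (m - n) (roots_of_unity n - J)
     else (-1) ^ m * complete_hom_sym m (roots_of_unity n - J))"
proof -
  define K where "K = roots_of_unity n - J"
  define P where "P = (\<lambda>A. \<Prod>z\<in>A. 1 - fps_const z * fps_X :: complex fps)"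
  let ?H = "Abs_fps (\<lambda>m. complete_hom_sym m K)"
  have "finite J" "finite K"
    using assms(2) finite_roots_of_unity finite_subset by (auto simp: K_def)
  have "P K * P J = 1 - fps_X ^ n"
    using prod.subset_diff[OF assms(2) finite_roots_of_unity, of "\<lambda>z. 1 - fps_const z * fps_X"]
      prod_roots_of_unity_fps assms(1) by (simp add: P_def K_def)
  moreover have "P K * ?H = 1"
    unfolding P_def by (rule complete_hom_sym_generating_function) fact
  \<comment> \<open>Multiply the first identity by \<open>?H\<close>, which cancels
    \<open>P K\<close>.\<close>
  ultimately have "P J = (1 - fps_X ^ n) * ?H"
    by (metis mult.assoc mult.commute mult_1)
  also have "\<dots> = ?H - fps_X ^ n * ?H"
    by (simp add: algebra_simps)
  finally have "Abs_fps (\<lambda>m. (-1) ^ m * elem_sym m J) = ?H - fps_X ^ n * ?H"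
    using elem_sym_generating_function[OF \<open>finite J\<close>] by (simp add: P_def)
  from arg_cong[OF this, of "\<lambda>F. fps_nth F m"]
  have coeff: "(-1) ^ m * elem_sym m J
      = complete_hom_sym m K - (if n \<le> m then complete_hom_sym (m - n) K else 0)"
    by (simp add: fps_X_power_mult_nth)
  \<comment> \<open>The sign is its own inverse, so it can be moved to the other side.\<close>
  have "elem_sym m J = (-1) ^ m * ((-1) ^ m * elem_sym m J)"
    by (simp flip: mult.assoc power_mult_distrib)
  also have "\<dots> = (-1) ^ m * complete_hom_sym m K
      - (if n \<le> m then (-1) ^ m * complete_hom_sym (m - n) K else 0)"
    unfolding coeff by (simp add: algebra_simps)
  finally show ?thesis
    \<comment> \<open>For \<open>m = 0\<close> the case \<open>n \<le> m\<close> is excluded by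
      \<open>n \<ge> 1\<close>, so the truncated \<open>m - 1\<close> does no harm; for a successor,
      the minus sign is absorbed by lowering the exponent by one.\<close>
    using assms(1) by (cases m) (auto simp: K_def)
qed

end
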